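(* Let $a,b>-1$ with $\alpha:=a+b>-1$ and let $n\ge0$ be an integer. The polynomials $\widetilde p_n$ defined in the context are given, for $z\neq0$, by $$\widetilde p_n(z)=\sum_{j=0}^n\frac{\Gamma(\alpha+n+j+1)(-z)^j}{j!\,(n-j)!\,\Gamma(\alpha+j+1)\Gamma(a+j+1)}=\frac{\Gamma(\alpha+n+1)}{n!\,\Gamma(\alpha+1)\Gamma(a+1)}\;{}_2F_2\!\left({-n,\ \alpha+n+1\atop a+1,\ \alpha+1};z\right)$$ $$=\int_\gamma\frac{du}{2\pi i}\,\frac{\Gamma(\alpha+n-u+1)\,\Gamma(u)}{\Gamma(n+1+u)\,\Gamma(\alpha+1-u)\,\Gamma(a+1-u)}\,z^{-u},$$ where the integral representation is valid for any $z\ne0$. The corresponding expressions for the polynomials $\widetilde q_n$ follow from those for $\widetilde p_n$ by exchanging $a\leftrightarrow b$.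
   Context: Let $P_n(x)=\sum_{i=0}^nC_{n,i}x^i=\sum_{m=0}^n\frac{\Gamma(\alpha+n+m+1)}{m!(n-m)!\Gamma(\alpha+m+1)}(-x)^m$ be the $n$-th Jacobi polynomial on $[0,1]$ (i.e. $P_n^{(\alpha,0)}(1-2x)$), orthogonal for the weight $x^\alpha$. The Cauchy--Laguerre biorthogonal polynomials are $$\widetilde p_n(x)=\sum_{i=0}^nC_{n,i}\frac{x^i}{\Gamma(a+i+1)},\qquad \widetilde q_n(y)=\sum_{j=0}^nC_{n,j}\frac{y^j}{\Gamma(b+j+1)};$$ they are biorthogonal (not normalized) for the pairing $\int_0^\infty\!\int_0^\infty p(x)q(y)\frac{x^ay^be^{-x-y}}{x+y}dx\,dy$. The contour $\gamma$ originates at $-\infty$ in the lower half-plane and returns to $-\infty$ in the upper half-plane, enclosing the poles of $\Gamma(u)$, with the poles of $\Gamma(\alpha+n+1-u)$ in its exterior. *)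

theory Defs
  imports "HOL-Complex_Analysis.Complex_Analysis" "HOL-Library.Landau_Symbols"
begin

text \<open>
  The Jacobi polynomial \<open>P_n\<close> for the weight \<open>x^\<alpha>\<close> on \<open>[0,1]\<close>, i.e. the classical one with parameters
  \<open>(\<alpha>, 0)\<close> at \<open>1 - 2 x\<close>. Its coefficients are the numbers \<open>C_{n,i}\<close>.
\<close>

definition jacobi01 :: "real \<Rightarrow> nat \<Rightarrow> real poly" where
  "jacobi01 \<alpha> n =
     (\<Sum>m\<le>n. monom (Gamma (\<alpha> + real n + real m + 1) /
                     (fact m * fact (n - m) * Gamma (\<alpha> + real m + 1)) * (-1) ^ m) m)"

definition cauchy_laguerre_p :: "real \<Rightarrow> real \<Rightarrow> nat \<Rightarrow> complex poly" where
  "cauchy_laguerre_p a b n =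
     (\<Sum>i\<le>n. monom (of_real (coeff (jacobi01 (a + b) n) i / Gamma (a + real i + 1))) i)"

definition cauchy_laguerre_q :: "real \<Rightarrow> real \<Rightarrow> nat \<Rightarrow> complex poly" where
  "cauchy_laguerre_q a b n =
     (\<Sum>j\<le>n. monom (of_real (coeff (jacobi01 (a + b) n) j / Gamma (b + real j + 1))) j)"

definition hypergeometric_F :: "complex list \<Rightarrow> complex list \<Rightarrow> complex \<Rightarrow> complex" where
  "hypergeometric_F as bs z = eval_fps (fps_hypergeo as bs 1) z"

text \<open>
  An infinite contour is parametrised by the whole real line. It originates at \<open>-\<infinity>\<close> in the lower
  half-plane and returns to \<open>-\<infinity>\<close> in the upper half-plane. Besides \<open>Re \<gamma> \<rightarrow> -\<infinity>\<close>, tending to \<open>-\<infinity>\<close>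
  includes that the ends stay in a sector around the negative real axis; without it the
  contour could escape in the direction \<open>\<plusminus>\<i>\<infinity>\<close>, where integrals of quotients of Gamma functions
  may diverge.
\<close>

definition loop_from_minus_infinity :: "(real \<Rightarrow> complex) \<Rightarrow> bool" where
  "loop_from_minus_infinity \<gamma> \<longleftrightarrow>
     (\<forall>s t. s < t \<longrightarrow> valid_path (subpath s t \<gamma>)) \<and>
     filterlim (\<lambda>t. Re (\<gamma> t)) at_bot at_bot \<and>
     filterlim (\<lambda>t. Re (\<gamma> t)) at_bot at_top \<and>
     (\<lambda>t. Im (\<gamma> t)) \<in> O[at_bot](\<lambda>t. Re (\<gamma> t)) \<and>
     (\<lambda>t. Im (\<gamma> t)) \<in> O[at_top](\<lambda>t. Re (\<gamma> t)) \<and>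
     (\<forall>\<^sub>F t in at_bot. Im (\<gamma> t) < 0) \<and>
     (\<forall>\<^sub>F t in at_top. Im (\<gamma> t) > 0)"

text \<open>
  The winding number of such a loop about a point off the loop is that of a long finite part of
  the loop closed by a segment, which eventually lies to the left of the point.
\<close>

definition loop_winds :: "(real \<Rightarrow> complex) \<Rightarrow> complex \<Rightarrow> complex \<Rightarrow> bool" where
  "loop_winds \<gamma> p w \<longleftrightarrow>
     p \<notin> range \<gamma> \<and>
     (\<forall>\<^sub>F (s, t) in at_bot \<times>\<^sub>F at_top.
        winding_number (subpath s t \<gamma> +++ linepath (\<gamma> t) (\<gamma> s)) p = w)"

definition contour_\<gamma> :: "real \<Rightarrow> nat \<Rightarrow> (real \<Rightarrow> complex) \<Rightarrow> bool" where
  "contour_\<gamma> \<alpha> n \<gamma> \<longleftrightarrow>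
     loop_from_minus_infinity \<gamma> \<and>
     (\<forall>p. is_pole Gamma p \<longrightarrow> loop_winds \<gamma> p 1) \<and>
     (\<forall>p. is_pole (\<lambda>u. Gamma (of_real \<alpha> + of_nat n + 1 - u)) p \<longrightarrow> loop_winds \<gamma> p 0)"

text \<open>The improper integral along an infinite contour; the two ends tend to infinity independently.\<close>

definition has_loop_integral ::
    "(complex \<Rightarrow> complex) \<Rightarrow> complex \<Rightarrow> (real \<Rightarrow> complex) \<Rightarrow> bool" where
  "has_loop_integral f I \<gamma> \<longleftrightarrow>
     (\<forall>s t. s < t \<longrightarrow> f contour_integrable_on subpath s t \<gamma>) \<and>
     ((\<lambda>(s, t). contour_integral (subpath s t \<gamma>) f) \<longlongrightarrow> I) (at_bot \<times>\<^sub>F at_top)"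

end

theory Submission
  imports Defs
begin

text \<open>
  The finite sum is the definition of the polynomial with the Jacobi coefficients written out, and the
  \<open>\<^sub>2F\<^sub>2\<close> form is the same sum again: the upper parameter \<open>- n\<close> cuts the series off after \<open>j = n\<close>, and each
  Pochhammer symbol is a quotient of Gamma values. The contour integral carries the content.

  The quotient \<open>\<Gamma>(u) / \<Gamma>(n + 1 + u)\<close> is \<open>1 / (u (u + 1) \<dots> (u + n))\<close>, and
  \<open>\<Gamma>(\<alpha> + n + 1 - u) / \<Gamma>(\<alpha> + 1 - u)\<close> is a polynomial of degree \<open>n\<close>. Hence, off the poles of the
  Gamma factors, the integrand is \<open>mellin_barnes_kernel\<close> times \<open>1 / (2 \<pi> \<i>)\<close>, and the kernel is an
  entire function divided by a polynomial whose zeros \<open>0, -1, \<dots>, -n\<close> are simple. The residue at \<open>-j\<close> is the \<open>j\<close>-th term of the finite sum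
  (\<open>residue_mellin_barnes_kernel\<close>).

  To turn the infinite contour into a closed one, join the ends of a long finite piece by a segment
  (\<open>residue_theorem_loop_from_minus_infinity\<close>). Both ends lie in a sector around the negative axis,
  far to the left; such a truncated sector is convex, so the segment lies in it as well and avoids the
  poles. The closed path winds once around each pole, and it remains to see that the segment
  contributes nothing in the limit. The two ends move independently, so the segment may be very
  long compared with its distance from the origin. A bound \<open>K / (Re u)\<^sup>2\<close> for the integrand
  copes with this, because it integrates over a segment from \<open>P\<close> to \<open>Q\<close> to exactly
  \<open>K \<bar>Q - P\<bar> / (Re P Re Q)\<close>, and in a sector \<open>\<bar>Q - P\<bar>\<close> is at most a multiple of
  \<open>\<bar>Re P\<bar> + \<bar>Re Q\<bar>\<close>.

  That bound comes from the factor \<open>1 / \<Gamma>(a + 1 - u)\<close>, since all other factors grow at most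
  exponentially. Comparing the Euler limit for \<open>1 / \<Gamma>(x + \<i> y)\<close> factor by factor with the one for \<open>1 / \<Gamma>(x)\<close> costs only
  \<open>exp (y\<^sup>2 / (2 (x - 1)))\<close>, which is exponential in \<open>x\<close> inside a sector, whereas \<open>1 / \<Gamma>(x)\<close> decays faster
  than every exponential by the functional equation.
\<close>

section \<open>Decay of the reciprocal Gamma function in sectors\<close>

lemma sum_inverse_squares_shift_le:
  fixes x :: real
  assumes "x > 1"
  shows "(\<Sum>k<N. 1 / (x + real k)\<^sup>2) \<le> 1 / (x - 1)"
proof -
  have "(\<Sum>k<N. 1 / (x + real k)\<^sup>2) \<le> 1 / (x - 1) - 1 / (x - 1 + real N)"
  proof (induction N)
    case (Suc N)
    have "1 / (x + real N)\<^sup>2 \<le> 1 / ((x - 1 + real N) * (x + real N))"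
      using assms by (intro divide_left_mono) (auto simp: power2_eq_square mult_right_mono)
    also have "\<dots> = 1 / (x - 1 + real N) - 1 / (x + real N)"
    proof -
      have "x - 1 + real N \<noteq> 0" "x + real N \<noteq> 0"
        using assms by auto
      then show ?thesis by (simp add: diff_frac_eq)
    qed
    finally have "1 / (x + real N)\<^sup>2 \<le> 1 / (x - 1 + real N) - 1 / (x + real N)" .
    with Suc show ?case by (simp add: algebra_simps)
  qed simp
  also have "\<dots> \<le> 1 / (x - 1)"
    using assms by simp
  finally show ?thesis .
qed

text \<open>
  Each factor satisfies \<open>\<bar>s + k\<bar>\<^sup>2 = (x + k)\<^sup>2 (1 + y\<^sup>2 / (x + k)\<^sup>2)\<close> for \<open>s = x + \<i> y\<close>; with
  \<open>1 + t \<le> exp t\<close> the excess over \<open>x + k\<close> becomes a factor \<open>exp (y\<^sup>2 / (2 (x + k)\<^sup>2))\<close>, and these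
  multiply to a bound independent of \<open>N\<close>.
\<close>

lemma norm_pochhammer_le:
  fixes s :: complex
  assumes "Re s > 1"
  shows "norm (pochhammer s N) \<le> pochhammer (Re s) N * exp ((Im s)\<^sup>2 / (2 * (Re s - 1)))"
proof -
  have factor: "norm (s + of_nat k) \<le> (Re s + real k) * exp ((Im s)\<^sup>2 / 2 * (1 / (Re s + real k)\<^sup>2))" for k
  proof -
    define x where "x = Re s + real k"
    have x: "x > 0"
      using assms by (simp add: x_def)
    have "norm (s + of_nat k) ^ 2 = x\<^sup>2 * (1 + (Im s)\<^sup>2 / x\<^sup>2)"
      using x by (simp add: cmod_power2 distrib_left flip: x_def)
    also have "\<dots> \<le> x\<^sup>2 * exp ((Im s)\<^sup>2 / x\<^sup>2)"
      by (intro mult_left_mono) auto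
    also have "\<dots> = (x * exp ((Im s)\<^sup>2 / 2 * (1 / x\<^sup>2)))\<^sup>2"
      unfolding power_mult_distrib exp_double[symmetric] by simp
    finally show ?thesis
      unfolding x_def[symmetric] by (rule power2_le_imp_le) (use x in auto)
  qed
  have "norm (pochhammer s N) = (\<Prod>k<N. norm (s + of_nat k))"
    by (simp add: pochhammer_prod prod_norm lessThan_atLeast0)
  also have "\<dots> \<le> (\<Prod>k<N. (Re s + real k) * exp ((Im s)\<^sup>2 / 2 * (1 / (Re s + real k)\<^sup>2)))"
    by (intro prod_mono conjI factor) auto
  also have "\<dots> = pochhammer (Re s) N * exp ((Im s)\<^sup>2 / 2 * (\<Sum>k<N. 1 / (Re s + real k)\<^sup>2))"
    by (simp add: prod.distrib pochhammer_prod lessThan_atLeast0 exp_sum sum_distrib_left)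
  also have "\<dots> \<le> pochhammer (Re s) N * exp ((Im s)\<^sup>2 / 2 * (1 / (Re s - 1)))"
    using assms
    by (intro mult_left_mono pochhammer_nonneg iffD2[OF exp_le_cancel_iff] sum_inverse_squares_shift_le) auto
  finally show ?thesis by simp
qed

text \<open>
  Both sides are limits of \<open>rGamma_series\<close>, whose denominators at \<open>s\<close> and at \<open>Re s\<close> have the same
  absolute value, so only the Pochhammer symbols have to be compared.
\<close>

lemma norm_rGamma_le:
  fixes s :: complex
  assumes "Re s > 1"
  shows "norm (rGamma s) \<le> rGamma (Re s) * exp ((Im s)\<^sup>2 / (2 * (Re s - 1)))"
proof (rule LIMSEQ_le)
  show "(\<lambda>N. norm (rGamma_series s N)) \<longlonglongrightarrow> norm (rGamma s)"
    by (intro tendsto_intros)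
  show "(\<lambda>N. rGamma_series (Re s) N * exp ((Im s)\<^sup>2 / (2 * (Re s - 1))))
          \<longlonglongrightarrow> rGamma (Re s) * exp ((Im s)\<^sup>2 / (2 * (Re s - 1)))"
    by (intro tendsto_intros)
  have "norm (rGamma_series s N) \<le> rGamma_series (Re s) N * exp ((Im s)\<^sup>2 / (2 * (Re s - 1)))" for N
  proof -
    have "norm (rGamma_series s N) =
        norm (pochhammer s (N + 1)) / (fact N * exp (Re s * ln (real N)))"
      unfolding rGamma_series_def norm_divide norm_mult norm_exp_eq_Re by simp
    also have "\<dots> \<le> pochhammer (Re s) (N + 1) * exp ((Im s)\<^sup>2 / (2 * (Re s - 1))) /
        (fact N * exp (Re s * ln (real N)))"
      by (intro divide_right_mono norm_pochhammer_le[OF assms]) auto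
    finally show ?thesis
      by (simp only: rGamma_series_def of_real_eq_id id_apply times_divide_eq_left)
  qed
  then show "\<exists>N0. \<forall>N\<ge>N0. norm (rGamma_series s N)
          \<le> rGamma_series (Re s) N * exp ((Im s)\<^sup>2 / (2 * (Re s - 1)))"
    by blast
qed

text \<open>
  Passing from \<open>x - 1\<close> to \<open>x\<close> multiplies \<open>exp (M x) / \<Gamma>(x)\<close> by \<open>exp M / (x - 1)\<close>, which is at most 1 once
  \<open>x - 1 \<ge> exp M\<close>. A bound on a compact interval therefore propagates to the right.
\<close>

lemma rGamma_real_le_exp:
  fixes M :: real
  obtains K where "\<And>x. x \<ge> 1 \<Longrightarrow> rGamma x \<le> K * exp (- M * x)"
proof -
  define g where "g = (\<lambda>x. rGamma x * exp (M * x))"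
  define X where "X = max 1 (exp M)"
  have "continuous_on {1..X + 1} g"
    unfolding g_def by (intro continuous_intros)
  then have "bounded (g ` {1..X + 1})"
    by (intro compact_imp_bounded compact_continuous_image) auto
  then obtain K where "\<forall>y\<in>g ` {1..X + 1}. norm y \<le> K"
    unfolding bounded_iff by blast
  then have K: "g x \<le> K" if "x \<in> {1..X + 1}" for x
    using that abs_le_D1[of "g x" K] by simp
  have "g x \<le> K" if "1 \<le> x" "x \<le> X + 1 + real m" for x m
    using that
  proof (induction m arbitrary: x)
    case 0
    then show ?case using K by simp
  next
    case (Suc m)
    show ?case
    proof (cases "x \<le> X + 1")
      case True
      with Suc show ?thesis using K by simp
    next
      case False
      then have x: "x - 1 \<ge> exp M" "x - 1 \<ge> 1"
        by (auto simp: X_def)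
      have "g x = exp M / (x - 1) * g (x - 1)"
      proof -
        have "(x - 1) * rGamma x = rGamma (x - 1)"
          using rGamma_plus1[of "x - 1"] by simp
        then have "rGamma x = rGamma (x - 1) / (x - 1)"
          using x(2) by (simp add: eq_divide_eq mult.commute)
        moreover have "exp (M * x) = exp M * exp (M * (x - 1))"
          unfolding exp_add[symmetric] by (simp add: right_diff_distrib)
        ultimately show ?thesis by (simp add: g_def)
      qed
      also have "\<dots> \<le> 1 * g (x - 1)"
      proof (rule mult_right_mono)
        show "exp M / (x - 1) \<le> 1"
          using x by simp
        show "0 \<le> g (x - 1)"
          using x by (simp add: g_def rGamma_inverse_Gamma less_imp_le[OF Gamma_real_pos])
      qed
      also have "\<dots> \<le> K"
        using Suc.IH[of "x - 1"] Suc.prems x by simp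
      finally show ?thesis .
    qed
  qed
  then have g_le: "g x \<le> K" if "x \<ge> 1" for x
  proof -
    have "x \<le> X + 1 + real (nat \<lceil>x\<rceil>)"
      using real_nat_ceiling_ge[of x] by (simp add: X_def)
    then show ?thesis
      using that \<open>\<And>x m. 1 \<le> x \<Longrightarrow> x \<le> X + 1 + real m \<Longrightarrow> g x \<le> K\<close> by blast
  qed
  have "rGamma x \<le> K * exp (- M * x)" if "x \<ge> 1" for x
  proof -
    have "rGamma x = g x * exp (- M * x)"
      by (simp add: g_def exp_minus)
    also have "\<dots> \<le> K * exp (- M * x)"
      using g_le[OF that] by (intro mult_right_mono) auto
    finally show ?thesis .
  qed
  with that show ?thesis by blast
qed

lemma norm_pochhammer_le_exp:
  fixes w :: complex
  shows "norm (pochhammer w n) \<le> exp (real n * (norm w + real n))"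
proof -
  have "norm (pochhammer w n) = (\<Prod>k<n. norm (w + of_nat k))"
    by (simp add: pochhammer_prod prod_norm lessThan_atLeast0)
  also have "\<dots> \<le> (\<Prod>k<n. exp (norm w + real n))"
  proof (intro prod_mono conjI)
    fix k assume "k \<in> {..<n}"
    then have "norm (w + of_nat k) \<le> norm w + real n"
      using norm_triangle_ineq[of w "of_nat k"] by simp
    also have "\<dots> \<le> exp (norm w + real n)"
      using exp_ge_add_one_self[of "norm w + real n"] by linarith
    finally show "norm (w + of_nat k) \<le> exp (norm w + real n)" .
  qed auto
  finally show ?thesis
    by (simp add: exp_of_nat_mult)
qed

section \<open>Residues along a loop from minus infinity\<close>

text \<open>
  A rate of \<open>1 / \<bar>Re u\<bar>\<close> would be too weak: the integral of \<open>1 / u\<close> over a vertical segment across a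
  sector does not tend to 0 as the segment moves to the left. With the square the bound is
  integrable in closed form over any segment.
\<close>

definition decays_in_left_sectors :: "(complex \<Rightarrow> complex) \<Rightarrow> bool" where
  "decays_in_left_sectors f \<longleftrightarrow>
     (\<forall>C. \<exists>K R. \<forall>u. Re u \<le> - R \<and> \<bar>Im u\<bar> \<le> C * \<bar>Re u\<bar> \<longrightarrow> norm (f u) \<le> K / (Re u)\<^sup>2)"

text \<open>
  Along the segment \<open>Re u\<close> is an affine function \<open>r\<close> of the parameter \<open>\<tau>\<close>, and \<open>1 / r\<^sup>2\<close> has the
  primitive \<open>\<tau> / (r 0 \<cdot> r \<tau>)\<close>, also when \<open>r\<close> is constant. The bound is thus uniform in
  the slope of the segment.
\<close>

lemma norm_contour_integral_linepath_le:
  fixes P Q :: complex and f :: "complex \<Rightarrow> complex"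
  assumes "Re P < 0" "Re Q < 0" and cont: "continuous_on (closed_segment P Q) f"
    and bound: "\<And>u. u \<in> closed_segment P Q \<Longrightarrow> norm (f u) \<le> K / (Re u)\<^sup>2"
  shows "norm (contour_integral (linepath P Q) f) \<le> K * norm (Q - P) / (Re P * Re Q)"
proof -
  define r where "r = (\<lambda>\<tau>. (1 - \<tau>) * Re P + \<tau> * Re Q)"
  have r: "r \<tau> < 0" if "\<tau> \<in> {0..1}" for \<tau>
  proof (cases "\<tau> = 1")
    case False
    then have "(1 - \<tau>) * Re P < 0" "\<tau> * Re Q \<le> 0"
      using that assms by (auto simp: mult_less_0_iff mult_le_0_iff)
    then show ?thesis by (simp add: r_def)
  qed (use assms in \<open>simp add: r_def\<close>)
  have Re_line: "Re (linepath P Q \<tau>) = r \<tau>" for \<tau>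
    by (simp add: linepath_def r_def)
  have "((\<lambda>\<tau>. \<tau> / (Re P * r \<tau>)) has_vector_derivative 1 / (r \<tau>)\<^sup>2) (at \<tau> within {0..1})"
    if "\<tau> \<in> {0..1}" for \<tau>
    unfolding has_real_derivative_iff_has_vector_derivative[symmetric]
    using r[OF that] assms(1) unfolding r_def
    by (auto intro!: derivative_eq_intros simp: divide_simps) (simp add: algebra_simps power2_eq_square)
  then have "((\<lambda>\<tau>. 1 / (r \<tau>)\<^sup>2) has_integral (1 / (Re P * r 1) - 0 / (Re P * r 0))) {0..1}"
    by (intro fundamental_theorem_of_calculus) auto
  from has_integral_mult_right[OF this, of "K * norm (Q - P)"]
  have majorant: "((\<lambda>\<tau>. K / (r \<tau>)\<^sup>2 * norm (Q - P)) has_integral K * norm (Q - P) / (Re P * Re Q)) {0..1}"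
    by (simp add: r_def mult_ac)
  have integrable: "f contour_integrable_on linepath P Q"
    by (rule contour_integrable_continuous_linepath[OF cont])
  have "norm (integral {0..1} (\<lambda>\<tau>. f (linepath P Q \<tau>) * (Q - P)))
          \<le> integral {0..1} (\<lambda>\<tau>. K / (r \<tau>)\<^sup>2 * norm (Q - P))"
  proof (rule integral_norm_bound_integral)
    show "(\<lambda>\<tau>. f (linepath P Q \<tau>) * (Q - P)) integrable_on {0..1}"
      using integrable by (simp add: contour_integrable_on)
    show "(\<lambda>\<tau>. K / (r \<tau>)\<^sup>2 * norm (Q - P)) integrable_on {0..1}"
      using majorant by blast
    show "norm (f (linepath P Q \<tau>) * (Q - P)) \<le> K / (r \<tau>)\<^sup>2 * norm (Q - P)" if "\<tau> \<in> {0..1}" for \<tau>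
      unfolding norm_mult using bound[of "linepath P Q \<tau>"] that
      by (intro mult_right_mono) (auto simp: Re_line linepath_in_path)
  qed
  then show ?thesis
    using integral_unique[OF majorant] by (simp add: contour_integral_integral)
qed

text \<open>
  The truncated sector is an intersection of three half-planes and hence convex.
\<close>

lemma closed_segment_in_left_sector:
  fixes P Q :: complex
  assumes "Re P \<le> - r" "Re Q \<le> - r" "\<bar>Im P\<bar> \<le> C * - Re P" "\<bar>Im Q\<bar> \<le> C * - Re Q"
    and "u \<in> closed_segment P Q"
  shows "Re u \<le> - r \<and> \<bar>Im u\<bar> \<le> C * - Re u"
proof -
  have "convex ({u. Re u \<le> - r} \<inter> {u. C * Re u + 1 * Im u \<le> 0} \<inter> {u. C * Re u + (-1) * Im u \<le> 0})"
    using convex_halfspace_le[of "Complex C 1" 0] convex_halfspace_le[of "Complex C (-1)" 0]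
    by (intro convex_Int convex_halfspace_Re_le) (simp_all add: inner_complex_def)
  then have "closed_segment P Q \<subseteq>
    {u. Re u \<le> - r} \<inter> {u. C * Re u + 1 * Im u \<le> 0} \<inter> {u. C * Re u + (-1) * Im u \<le> 0}"
    using assms(1-4) by (intro closed_segment_subset) auto
  with assms(5) have "Re u \<le> - r" "C * Re u + 1 * Im u \<le> 0" "C * Re u + (-1) * Im u \<le> 0"
    by blast+
  then show ?thesis by (simp add: abs_le_iff)
qed

lemma loop_sectorE:
  assumes "loop_from_minus_infinity \<gamma>"
  obtains C where "C \<ge> 0" "\<forall>\<^sub>F t in at_bot. \<bar>Im (\<gamma> t)\<bar> \<le> C * \<bar>Re (\<gamma> t)\<bar>"
    "\<forall>\<^sub>F t in at_top. \<bar>Im (\<gamma> t)\<bar> \<le> C * \<bar>Re (\<gamma> t)\<bar>"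
proof -
  from assms obtain c1 c2
    where c: "\<forall>\<^sub>F t in at_bot. norm (Im (\<gamma> t)) \<le> c1 * norm (Re (\<gamma> t))"
      "\<forall>\<^sub>F t in at_top. norm (Im (\<gamma> t)) \<le> c2 * norm (Re (\<gamma> t))"
    unfolding loop_from_minus_infinity_def by (auto elim!: landau_o.bigE)
  define C where "C = max 0 (max c1 c2)"
  have mono: "c1 * \<bar>x\<bar> \<le> C * \<bar>x\<bar>" "c2 * \<bar>x\<bar> \<le> C * \<bar>x\<bar>" for x :: real
    by (auto simp: C_def intro!: mult_right_mono)
  show ?thesis
  proof (rule that)
    show "C \<ge> 0" by (simp add: C_def)
    show "\<forall>\<^sub>F t in at_bot. \<bar>Im (\<gamma> t)\<bar> \<le> C * \<bar>Re (\<gamma> t)\<bar>"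
      using c(1) by eventually_elim (use mono in \<open>auto intro: order_trans\<close>)
    show "\<forall>\<^sub>F t in at_top. \<bar>Im (\<gamma> t)\<bar> \<le> C * \<bar>Re (\<gamma> t)\<bar>"
      using c(2) by eventually_elim (use mono in \<open>auto intro: order_trans\<close>)
  qed
qed

lemma residue_theorem_subpath:
  assumes "finite S" "f holomorphic_on - S"
    and "valid_path (subpath s t \<gamma>)" "range \<gamma> \<inter> S = {}" "closed_segment (\<gamma> t) (\<gamma> s) \<inter> S = {}"
    and "\<And>p. p \<in> S \<Longrightarrow> winding_number (subpath s t \<gamma> +++ linepath (\<gamma> t) (\<gamma> s)) p = 1"
  shows "contour_integral (subpath s t \<gamma>) f =
           2 * of_real pi * \<i> * (\<Sum>p\<in>S. residue f p) - contour_integral (linepath (\<gamma> t) (\<gamma> s)) f"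
proof -
  have open_S: "open (- S)"
    using assms(1) by (simp add: open_Compl finite_imp_closed)
  have image: "path_image (subpath s t \<gamma>) \<subseteq> - S"
    using assms(4) by (auto simp: path_image_subpath_gen)
  have "contour_integral (subpath s t \<gamma> +++ linepath (\<gamma> t) (\<gamma> s)) f =
      of_real (2 * pi) * \<i> *
      (\<Sum>p\<in>S. winding_number (subpath s t \<gamma> +++ linepath (\<gamma> t) (\<gamma> s)) p * residue f p)"
  proof (rule Residue_theorem)
    show "f holomorphic_on UNIV - S"
      using assms(2) by (simp add: Compl_eq_Diff_UNIV)
    show "path_image (subpath s t \<gamma> +++ linepath (\<gamma> t) (\<gamma> s)) \<subseteq> UNIV - S"
      using image assms(5) by (subst path_image_join) auto
    show "valid_path (subpath s t \<gamma> +++ linepath (\<gamma> t) (\<gamma> s))"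
      using assms(3) by (intro valid_path_join) auto
  qed (use assms(1) in auto)
  moreover have "contour_integral (subpath s t \<gamma> +++ linepath (\<gamma> t) (\<gamma> s)) f =
      contour_integral (subpath s t \<gamma>) f + contour_integral (linepath (\<gamma> t) (\<gamma> s)) f"
  proof (rule contour_integral_join)
    show "f contour_integrable_on subpath s t \<gamma>"
      by (rule contour_integrable_holomorphic_simple[OF assms(2) open_S assms(3) image])
    show "f contour_integrable_on linepath (\<gamma> t) (\<gamma> s)"
      by (rule contour_integrable_holomorphic_simple[OF assms(2) open_S]) (use assms(5) in auto)
  qed (use assms(3) in auto)
  ultimately show ?thesis
    using assms(6) by (simp add: algebra_simps)
qed

text \<open>
  Far enough out, the segment that closes a finite piece of the loop lies left of all of \<open>S\<close> and inside
  the sector that contains the ends, so that \<open>residue_theorem_subpath\<close> applies and the decay of \<open>f\<close> makes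
  the integral over the segment vanish in the limit.
\<close>

lemma residue_theorem_loop_from_minus_infinity:
  assumes loop: "loop_from_minus_infinity \<gamma>" and S: "finite S"
    and winds: "\<And>p. p \<in> S \<Longrightarrow> loop_winds \<gamma> p 1"
    and holo: "f holomorphic_on - S" and decay: "decays_in_left_sectors f"
  shows "has_loop_integral f (2 * of_real pi * \<i> * (\<Sum>p\<in>S. residue f p)) \<gamma>"
proof -
  define I where "I = 2 * of_real pi * \<i> * (\<Sum>p\<in>S. residue f p)"
  have open_S: "open (- S)"
    using S by (simp add: open_Compl finite_imp_closed)
  have avoid: "range \<gamma> \<inter> S = {}"
    using winds unfolding loop_winds_def by blast
  have valid: "valid_path (subpath s t \<gamma>)" if "s < t" for s t
    using loop that by (simp add: loop_from_minus_infinity_def)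
  have Re_bot: "filterlim (\<lambda>t. Re (\<gamma> t)) at_bot at_bot"
    and Re_top: "filterlim (\<lambda>t. Re (\<gamma> t)) at_bot at_top"
    using loop by (simp_all add: loop_from_minus_infinity_def)
  obtain C where C: "C \<ge> 0" "\<forall>\<^sub>F t in at_bot. \<bar>Im (\<gamma> t)\<bar> \<le> C * \<bar>Re (\<gamma> t)\<bar>"
    "\<forall>\<^sub>F t in at_top. \<bar>Im (\<gamma> t)\<bar> \<le> C * \<bar>Re (\<gamma> t)\<bar>"
    using loop_sectorE[OF loop] by blast
  obtain K0 R where R: "\<And>u. Re u \<le> - R \<Longrightarrow> \<bar>Im u\<bar> \<le> C * \<bar>Re u\<bar> \<Longrightarrow> norm (f u) \<le> K0 / (Re u)\<^sup>2"
    using decay unfolding decays_in_left_sectors_def by blast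
  define K where "K = max 0 K0"
  obtain m where m: "\<And>p. p \<in> S \<Longrightarrow> norm p \<le> m"
    using finite_imp_bounded[OF S] unfolding bounded_iff by blast
  \<comment> \<open>Left of \<open>- r\<close> the decay estimate holds, no point of \<open>S\<close> lies, and the real part is negative.\<close>
  define r where "r = max R (max m 0) + 1"
  define far where "far = (\<lambda>t. Re (\<gamma> t) \<le> - r \<and> \<bar>Im (\<gamma> t)\<bar> \<le> C * \<bar>Re (\<gamma> t)\<bar>)"
  have far: "eventually far at_bot" "eventually far at_top"
    using Re_bot Re_top C(2,3) by (auto simp: far_def filterlim_at_bot eventually_conj_iff)
  have neg: "\<forall>\<^sub>F s :: real in at_bot. s < 0"
    by (auto simp: eventually_at_bot_dense)
  have far_ends: "\<forall>\<^sub>F (s, t) in at_bot \<times>\<^sub>F at_top. s < 0 \<and> 0 < t \<and> far s \<and> far t"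
    using eventually_prodI[OF eventually_conj[OF neg far(1)]
        eventually_conj[OF eventually_gt_at_top[of 0] far(2)]]
    by (auto elim: eventually_mono)
  have wind: "\<forall>\<^sub>F (s, t) in at_bot \<times>\<^sub>F at_top. \<forall>p\<in>S.
      winding_number (subpath s t \<gamma> +++ linepath (\<gamma> t) (\<gamma> s)) p = 1"
    unfolding case_prod_unfold
    using winds unfolding loop_winds_def case_prod_unfold by (intro eventually_ball_finite S) auto
  have close: "\<forall>\<^sub>F (s, t) in at_bot \<times>\<^sub>F at_top.
      norm (contour_integral (subpath s t \<gamma>) f - I)
        \<le> K * (1 + C) * (inverse (- Re (\<gamma> s)) + inverse (- Re (\<gamma> t)))"
    using eventually_conj[OF far_ends wind]
  proof (rule eventually_mono, clarify)
    fix s t :: real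
    assume st: "s < 0" "0 < t" "far s" "far t"
      and w: "\<forall>p\<in>S. winding_number (subpath s t \<gamma> +++ linepath (\<gamma> t) (\<gamma> s)) p = 1"
    have r: "r \<ge> 1" "r \<ge> R" "r > m"
      by (auto simp: r_def)
    have neg: "Re (\<gamma> s) < 0" "Re (\<gamma> t) < 0"
      and Im: "\<bar>Im (\<gamma> s)\<bar> \<le> C * - Re (\<gamma> s)" "\<bar>Im (\<gamma> t)\<bar> \<le> C * - Re (\<gamma> t)"
      using st r by (auto simp: far_def)
    have seg: "Re u \<le> - r" "\<bar>Im u\<bar> \<le> C * \<bar>Re u\<bar>" if "u \<in> closed_segment (\<gamma> t) (\<gamma> s)" for u
      using closed_segment_in_left_sector[OF _ _ Im(2,1) that, of r] st r
      by (auto simp: far_def)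
    have disj: "closed_segment (\<gamma> t) (\<gamma> s) \<inter> S = {}"
    proof -
      have "u \<notin> S" if "u \<in> closed_segment (\<gamma> t) (\<gamma> s)" for u
        using seg(1)[OF that] m[of u] abs_Re_le_cmod[of u] r by force
      then show ?thesis by blast
    qed
    have "contour_integral (subpath s t \<gamma>) f - I = - contour_integral (linepath (\<gamma> t) (\<gamma> s)) f"
      using residue_theorem_subpath[OF S holo valid avoid disj] w st by (simp add: I_def)
    then have "norm (contour_integral (subpath s t \<gamma>) f - I)
        = norm (contour_integral (linepath (\<gamma> t) (\<gamma> s)) f)"
      by simp
    also have "\<dots> \<le> K * norm (\<gamma> s - \<gamma> t) / (Re (\<gamma> t) * Re (\<gamma> s))"
    proof (rule norm_contour_integral_linepath_le)
      show "continuous_on (closed_segment (\<gamma> t) (\<gamma> s)) f"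
        using holo disj by (intro holomorphic_on_imp_continuous_on[OF holomorphic_on_subset]) auto
      fix u assume u: "u \<in> closed_segment (\<gamma> t) (\<gamma> s)"
      have "norm (f u) \<le> K0 / (Re u)\<^sup>2"
        using seg[OF u] r by (intro R) auto
      also have "\<dots> \<le> K / (Re u)\<^sup>2"
        by (intro divide_right_mono) (auto simp: K_def)
      finally show "norm (f u) \<le> K / (Re u)\<^sup>2" .
    qed (use neg in auto)
    also have "\<dots> \<le> K * ((1 + C) * (- Re (\<gamma> s) - Re (\<gamma> t))) / (Re (\<gamma> t) * Re (\<gamma> s))"
    proof (intro divide_right_mono mult_left_mono)
      have "norm (\<gamma> s - \<gamma> t) \<le> norm (\<gamma> s) + norm (\<gamma> t)"
        by (rule norm_triangle_ineq4)
      also have "\<dots> \<le> (\<bar>Re (\<gamma> s)\<bar> + \<bar>Im (\<gamma> s)\<bar>) + (\<bar>Re (\<gamma> t)\<bar> + \<bar>Im (\<gamma> t)\<bar>)"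
        by (intro add_mono cmod_le)
      also have "\<dots> \<le> (1 + C) * (- Re (\<gamma> s) - Re (\<gamma> t))"
        using Im neg by (simp add: algebra_simps)
      finally show "norm (\<gamma> s - \<gamma> t) \<le> (1 + C) * (- Re (\<gamma> s) - Re (\<gamma> t))" .
    qed (use neg in \<open>auto simp: K_def mult_nonpos_nonpos\<close>)
    also have "\<dots> = K * (1 + C) * (inverse (- Re (\<gamma> s)) + inverse (- Re (\<gamma> t)))"
      using neg by (simp add: field_simps)
    finally show "norm (contour_integral (subpath s t \<gamma>) f - I)
        \<le> K * (1 + C) * (inverse (- Re (\<gamma> s)) + inverse (- Re (\<gamma> t)))" .
  qed
  have inv_lim: "((\<lambda>t. inverse (- Re (\<gamma> t))) \<longlongrightarrow> 0) at_bot" "((\<lambda>t. inverse (- Re (\<gamma> t))) \<longlongrightarrow> 0) at_top"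
    by (rule tendsto_inverse_0_at_top, 
        rule filterlim_compose[OF filterlim_uminus_at_top_at_bot], rule Re_bot Re_top)+
  have "((\<lambda>x. K * (1 + C) * (inverse (- Re (\<gamma> (fst x))) + inverse (- Re (\<gamma> (snd x))))) \<longlongrightarrow>
           K * (1 + C) * (0 + 0)) (at_bot \<times>\<^sub>F at_top)"
    by (intro tendsto_intros filterlim_compose[OF inv_lim(1) filterlim_fst]
        filterlim_compose[OF inv_lim(2) filterlim_snd])
  then have "((\<lambda>x. contour_integral (subpath (fst x) (snd x) \<gamma>) f - I) \<longlongrightarrow> 0) (at_bot \<times>\<^sub>F at_top)"
    by (intro Lim_null_comparison[OF close[unfolded case_prod_unfold]]) simp
  then have "((\<lambda>(s, t). contour_integral (subpath s t \<gamma>) f) \<longlongrightarrow> I) (at_bot \<times>\<^sub>F at_top)"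
    by (simp add: case_prod_unfold LIM_zero_iff)
  moreover have "f contour_integrable_on subpath s t \<gamma>" if "s < t" for s t
    using avoid
    by (intro contour_integrable_holomorphic_simple[OF holo open_S valid[OF that]])
       (auto simp: path_image_subpath_gen)
  ultimately show ?thesis
    by (simp add: has_loop_integral_def I_def)
qed

lemma has_loop_integral_cong:
  assumes "\<And>u. u \<in> range \<gamma> \<Longrightarrow> f u = g u"
  shows "has_loop_integral f I \<gamma> \<longleftrightarrow> has_loop_integral g I \<gamma>"
proof -
  have eq: "f u = g u" if "u \<in> path_image (subpath s t \<gamma>)" for s t u
    using that assms by (auto simp: path_image_subpath_gen)
  have "contour_integral (subpath s t \<gamma>) f = contour_integral (subpath s t \<gamma>) g" for s t
    by (rule contour_integral_eq) (use eq in auto)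
  moreover have "f contour_integrable_on subpath s t \<gamma> \<longleftrightarrow> g contour_integrable_on subpath s t \<gamma>" for s t
    using contour_integrable_eq[of f "subpath s t \<gamma>" g] contour_integrable_eq[of g "subpath s t \<gamma>" f] eq
    by auto
  ultimately show ?thesis
    unfolding has_loop_integral_def by simp
qed


lemma has_loop_integral_lmul:
  assumes "has_loop_integral f I \<gamma>"
  shows "has_loop_integral (\<lambda>u. c * f u) (c * I) \<gamma>"
  unfolding has_loop_integral_def
proof (intro conjI allI impI)
  have int: "f contour_integrable_on subpath s t \<gamma>" if "s < t" for s t
    using assms that by (simp add: has_loop_integral_def)
  then show "(\<lambda>u. c * f u) contour_integrable_on subpath s t \<gamma>" if "s < t" for s t
    using that by (intro contour_integrable_lmul)
  have "\<forall>\<^sub>F x in at_bot \<times>\<^sub>F at_top. fst x < (0::real) \<and> (0::real) < snd x"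
    by (rule eventually_prodI) (auto simp: eventually_at_bot_dense eventually_at_top_dense)
  then have "\<forall>\<^sub>F x in at_bot \<times>\<^sub>F at_top. c * (case x of (s, t) \<Rightarrow> contour_integral (subpath s t \<gamma>) f) =
      (case x of (s, t) \<Rightarrow> contour_integral (subpath s t \<gamma>) (\<lambda>u. c * f u))"
    by eventually_elim (auto simp: contour_integral_lmul[OF int])
  moreover have "((\<lambda>x. c * (case x of (s, t) \<Rightarrow> contour_integral (subpath s t \<gamma>) f)) \<longlongrightarrow> c * I)
      (at_bot \<times>\<^sub>F at_top)"
    using assms unfolding has_loop_integral_def by (intro tendsto_mult_left) blast
  ultimately show "((\<lambda>(s, t). contour_integral (subpath s t \<gamma>) (\<lambda>u. c * f u)) \<longlongrightarrow> c * I)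
      (at_bot \<times>\<^sub>F at_top)"
    by (rule Lim_transform_eventually[rotated])
qed

section \<open>The Mellin-Barnes kernel\<close>

lemma norm_pochhammer_ge_1:
  fixes u :: complex
  assumes "Re u \<le> - real n"
  shows "1 \<le> norm (pochhammer u n)"
proof -
  have "(\<Prod>k<n. 1) \<le> (\<Prod>k<n. norm (u + of_nat k))"
  proof (intro prod_mono conjI)
    fix k assume "k \<in> {..<n}"
    then have "1 \<le> \<bar>Re (u + of_nat k)\<bar>"
      using assms by auto
    also have "\<dots> \<le> norm (u + of_nat k)"
      by (rule abs_Re_le_cmod)
    finally show "1 \<le> norm (u + of_nat k)" .
  qed auto
  then show ?thesis
    by (simp add: pochhammer_prod prod_norm lessThan_atLeast0)
qed

text \<open>
  The integrand of the contour integral, up to the constant \<open>1 / (2 \<pi> \<i>)\<close>, with its removable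
  singularities removed. The Gamma quotient takes the default value 0 where one of its Gamma factors
  has a pole; this form is holomorphic off \<open>{0, -1, \<dots>, -n}\<close>.
\<close>

definition mellin_barnes_kernel :: "real \<Rightarrow> real \<Rightarrow> nat \<Rightarrow> complex \<Rightarrow> complex \<Rightarrow> complex" where
  "mellin_barnes_kernel a \<alpha> n z u =
     pochhammer (of_real \<alpha> + 1 - u) n * rGamma (of_real a + 1 - u) * z powr (- u) /
     pochhammer u (Suc n)"

text \<open>
  With \<open>x = - Re u\<close>, the polynomial, the power of \<open>z\<close> and the correction factor in \<open>norm_rGamma_le\<close> all grow at
  most exponentially in \<open>x\<close> inside the sector, and \<open>rGamma_real_le_exp\<close> beats any given exponential.
\<close>

lemma mellin_barnes_kernel_decays:
  assumes "a > -1" "z \<noteq> 0"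
  shows "decays_in_left_sectors (mellin_barnes_kernel a \<alpha> n z)"
  unfolding decays_in_left_sectors_def
proof
  fix C0 :: real
  define C where "C = max 0 C0"
  define D where "D = (real n + norm (Ln z)) * (1 + C)"
  have C: "C \<ge> 0" "C0 \<le> C" and D: "D \<ge> 0"
    by (auto simp: C_def D_def)
  \<comment> \<open>The exponent pays for the correction factor (\<open>C\<^sup>2\<close>) and for the polynomial and the power of \<open>z\<close> (\<open>D\<close>),
      and leaves \<open>exp (- 2 x) \<le> 1 / x\<^sup>2\<close>.\<close>
  obtain K where K: "\<And>x. x \<ge> 1 \<Longrightarrow> rGamma x \<le> K * exp (- (C\<^sup>2 + D + 2) * x)"
    using rGamma_real_le_exp by blast
  define E where "E = exp (real n * (norm (of_real \<alpha> + 1 :: complex) + real n))"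
  have E_pos: "E > 0"
    by (simp add: E_def)
  have K_nonneg: "K \<ge> 0"
    using K[of 1] order_trans[of 0 1 "K * exp (- (C\<^sup>2 + D + 2) * 1)"] by (simp add: zero_le_mult_iff)
  have "norm (mellin_barnes_kernel a \<alpha> n z u) \<le> E * K / (Re u)\<^sup>2"
    if u: "Re u \<le> - (real n + 2)" "\<bar>Im u\<bar> \<le> C0 * \<bar>Re u\<bar>" for u
  proof -
    define x where "x = - Re u"
    define s where "s = of_real a + 1 - u"
    have x: "x \<ge> real n + 2"
      using u by (simp add: x_def)
    have s: "Re s > 1" "Re s \<ge> 2" "Re s \<ge> x"
      using x assms by (auto simp: s_def x_def)
    have Im_u: "\<bar>Im u\<bar> \<le> C * x"
    proof -
      have "C0 * \<bar>Re u\<bar> \<le> C * \<bar>Re u\<bar>"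
        using C by (intro mult_right_mono) auto
      moreover have "\<bar>Re u\<bar> = x"
        using x by (simp add: x_def)
      ultimately show ?thesis using u(2) by simp
    qed
    have norm_u: "norm u \<le> (1 + C) * x"
      using cmod_le[of u] Im_u x by (simp add: x_def algebra_simps)
    have "norm (rGamma s) \<le> rGamma (Re s) * exp ((Im s)\<^sup>2 / (2 * (Re s - 1)))"
      using s by (intro norm_rGamma_le)
    also have "\<dots> \<le> rGamma (Re s) * exp (C\<^sup>2 * Re s)"
    proof (intro mult_left_mono iffD2[OF exp_le_cancel_iff])
      have "(Im s)\<^sup>2 \<le> (C * Re s)\<^sup>2"
      proof (rule power2_le_iff_abs_le[THEN iffD2])
        show "0 \<le> C * Re s" using C s by simp
        have "C * x \<le> C * Re s"
          using C s by (intro mult_left_mono) auto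
        then show "\<bar>Im s\<bar> \<le> C * Re s" using Im_u by (simp add: s_def)
      qed
      also have "\<dots> = C\<^sup>2 * Re s * Re s"
        by (simp add: power2_eq_square)
      also have "\<dots> \<le> C\<^sup>2 * Re s * (2 * (Re s - 1))"
        using s by (intro mult_left_mono) auto
      finally show "(Im s)\<^sup>2 / (2 * (Re s - 1)) \<le> C\<^sup>2 * Re s"
        using s by (simp add: field_simps)
      show "0 \<le> rGamma (Re s)"
        using s by (simp add: rGamma_inverse_Gamma less_imp_le[OF Gamma_real_pos])
    qed
    also have "\<dots> \<le> K * exp (- (C\<^sup>2 + D + 2) * Re s) * exp (C\<^sup>2 * Re s)"
      using s by (intro mult_right_mono K) auto
    also have "\<dots> = K * exp (- (D + 2) * Re s)"
      by (simp add: mult.assoc algebra_simps flip: exp_add)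
    also have "\<dots> \<le> K * exp (- (D + 2) * x)"
    proof (rule mult_left_mono)
      show "exp (- (D + 2) * Re s) \<le> exp (- (D + 2) * x)"
        using D s by (simp add: mult_left_mono)
    qed (fact K_nonneg)
    finally have rG: "norm (rGamma s) \<le> K * exp (- (D + 2) * x)" .
    have "norm (pochhammer (of_real \<alpha> + 1 - u) n)
            \<le> exp (real n * (norm (of_real \<alpha> + 1 - u) + real n))"
      by (rule norm_pochhammer_le_exp)
    also have "\<dots> \<le> exp (real n * (norm (of_real \<alpha> + 1 :: complex) + real n) + real n * norm u)"
    proof -
      have "real n * norm (of_real \<alpha> + 1 - u) \<le> real n * (norm (of_real \<alpha> + 1 :: complex) + norm u)"
        by (intro mult_left_mono norm_triangle_ineq4) auto
      then show ?thesis by (simp add: algebra_simps)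
    qed
    finally have po: "norm (pochhammer (of_real \<alpha> + 1 - u) n) \<le> E * exp (real n * norm u)"
      by (simp add: E_def exp_add)
    have zp: "norm (z powr (- u)) \<le> exp (norm (Ln z) * norm u)"
    proof -
      have "norm (z powr (- u)) = exp (Re (- u * Ln z))"
        using assms by (simp add: powr_def)
      also have "\<dots> \<le> exp (norm (- u * Ln z))"
        using complex_Re_le_cmod by (simp only: exp_le_cancel_iff)
      finally show ?thesis by (simp add: norm_mult mult.commute)
    qed
    have "norm (mellin_barnes_kernel a \<alpha> n z u)
            \<le> norm (pochhammer (of_real \<alpha> + 1 - u) n) * norm (rGamma s) * norm (z powr (- u)) / 1"
      unfolding mellin_barnes_kernel_def norm_divide norm_mult s_def[symmetric]
      using norm_pochhammer_ge_1[of u "Suc n"] x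
      by (intro divide_left_mono) (auto simp: x_def simp del: pochhammer_Suc)
    also have "\<dots> \<le> (E * exp (real n * norm u)) * (K * exp (- (D + 2) * x)) * exp (norm (Ln z) * norm u) / 1"
    proof -
      have "norm (pochhammer (of_real \<alpha> + 1 - u) n) * norm (rGamma s)
              \<le> (E * exp (real n * norm u)) * (K * exp (- (D + 2) * x))"
        using po rG by (rule mult_mono) (use E_pos in auto)
      then have "norm (pochhammer (of_real \<alpha> + 1 - u) n) * norm (rGamma s) * norm (z powr (- u))
              \<le> (E * exp (real n * norm u)) * (K * exp (- (D + 2) * x)) * exp (norm (Ln z) * norm u)"
        using zp by (rule mult_mono) (use E_pos K_nonneg in auto)
      then show ?thesis by simp
    qed
    also have "\<dots> = E * K * (exp (real n * norm u) * exp (- (D + 2) * x) * exp (norm (Ln z) * norm u))"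
      by simp
    also have "\<dots> = E * K * exp ((real n + norm (Ln z)) * norm u - (D + 2) * x)"
      unfolding exp_add[symmetric] by (simp add: algebra_simps)
    also have "\<dots> \<le> E * K * exp (- (2 * x))"
    proof (rule mult_left_mono)
      have "(real n + norm (Ln z)) * norm u \<le> (real n + norm (Ln z)) * ((1 + C) * x)"
        using norm_u by (intro mult_left_mono) auto
      also have "\<dots> = D * x"
        by (simp add: D_def)
      finally show "exp ((real n + norm (Ln z)) * norm u - (D + 2) * x) \<le> exp (- (2 * x))"
        by (simp add: algebra_simps)
      show "0 \<le> E * K"
        using E_pos K_nonneg by simp
    qed
    also have "\<dots> \<le> E * K * (1 / x\<^sup>2)"
    proof (rule mult_left_mono)
      have "x\<^sup>2 \<le> (exp x)\<^sup>2"
        using x exp_ge_add_one_self[of x] by (intro power_mono) linarith+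
      also have "\<dots> = exp (2 * x)"
        by (simp flip: exp_double)
      finally show "exp (- (2 * x)) \<le> 1 / x\<^sup>2"
        using x by (simp add: exp_minus field_simps)
      show "0 \<le> E * K"
        using E_pos K_nonneg by simp
    qed
    finally show ?thesis by (simp add: x_def)
  qed
  then show "\<exists>K R. \<forall>u. Re u \<le> - R \<and> \<bar>Im u\<bar> \<le> C0 * \<bar>Re u\<bar> \<longrightarrow>
               norm (mellin_barnes_kernel a \<alpha> n z u) \<le> K / (Re u)\<^sup>2"
    by blast
qed

section \<open>Residues of the kernel\<close>

text \<open>
  This is the derivative of \<open>u (u + 1) \<dots> (u + n)\<close> at \<open>- j\<close>, i.e. the denominator of the residue there.
\<close>

lemma prod_differences_except:
  assumes "j \<le> n"
  shows "(\<Prod>k\<in>{0..n} - {j}. of_nat k - of_nat j) = ((-1) ^ j * fact j * fact (n - j) :: 'a :: field_char_0)"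
proof -
  have split: "{0..n} - {j} = {0..<j} \<union> {j + 1..n}"
    using assms by auto
  have "(\<Prod>k\<in>{0..n} - {j}. of_nat k - of_nat j :: 'a) =
      (\<Prod>k\<in>{0..<j}. of_nat k - of_nat j) * (\<Prod>k\<in>{j + 1..n}. of_nat k - of_nat j)"
    unfolding split by (rule prod.union_disjoint) auto
  also have "(\<Prod>k\<in>{0..<j}. of_nat k - of_nat j :: 'a) = pochhammer (- of_nat j) j"
    by (simp add: pochhammer_prod)
  also have "\<dots> = (-1) ^ j * fact j"
    by (rule pochhammer_same)
  also have "(\<Prod>k\<in>{j + 1..n}. of_nat k - of_nat j :: 'a) = (\<Prod>i\<in>{1..n - j}. of_nat i)"
    by (rule prod.reindex_bij_witness[of _ "\<lambda>i. i + j" "\<lambda>k. k - j"]) (use assms in \<open>auto simp: of_nat_diff\<close>)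
  also have "\<dots> = fact (n - j)"
    by (simp add: fact_prod)
  finally show ?thesis by simp
qed

text \<open>
  The three expressions meet in these numbers: they are the coefficients of \<open>z^j\<close> in the polynomial and
  in the rescaled hypergeometric series, and \<open>z^j\<close> times them is the residue of the kernel at \<open>- j\<close>.
\<close>

definition cauchy_laguerre_coeff :: "real \<Rightarrow> real \<Rightarrow> nat \<Rightarrow> nat \<Rightarrow> real" where
  "cauchy_laguerre_coeff a \<alpha> n j = (-1) ^ j * Gamma (\<alpha> + real n + real j + 1) /
     (fact j * fact (n - j) * Gamma (\<alpha> + real j + 1) * Gamma (a + real j + 1))"

lemma residue_mellin_barnes_kernel:
  assumes "\<alpha> > -1" "z \<noteq> 0" "j \<le> n"
  shows "residue (mellin_barnes_kernel a \<alpha> n z) (- of_nat j) = of_real (cauchy_laguerre_coeff a \<alpha> n j) * z ^ j"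
proof -
  define q where "q = (\<lambda>u::complex. \<Prod>k\<in>{0..n} - {j}. u + of_nat k)"
  define H where "H = (\<lambda>u. pochhammer (of_real \<alpha> + 1 - u) n * rGamma (of_real a + 1 - u) *
      z powr (- u) / q u)"
  \<comment> \<open>The complement of the other poles, on which \<open>H\<close> is holomorphic.\<close>
  define U where "U = - ((\<lambda>k. - of_nat k :: complex) ` ({0..n} - {j}))"
  have poch: "pochhammer u (Suc n) = q u * (u + of_nat j)" for u :: complex
    using prod.remove[of "{0..n}" j "\<lambda>k. u + of_nat k"] assms(3)
    by (simp add: pochhammer_Suc_prod q_def)
  have kernel: "mellin_barnes_kernel a \<alpha> n z = (\<lambda>u. H u / (u - (- of_nat j)))"
    by (simp add: fun_eq_iff mellin_barnes_kernel_def H_def poch del: pochhammer_Suc)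
  have "residue (mellin_barnes_kernel a \<alpha> n z) (- of_nat j) = H (- of_nat j)"
    unfolding kernel
  proof (rule residue_simple)
    show "open U"
      unfolding U_def by (intro open_Compl finite_imp_closed) auto
    show "- of_nat j \<in> U"
      by (auto simp: U_def)
    have "q u \<noteq> 0" if "u \<in> U" for u
      using that by (auto simp: q_def U_def add_eq_0_iff2)
    then show "H holomorphic_on U"
      unfolding H_def q_def pochhammer_prod using assms(2) 
      by (intro holomorphic_intros holomorphic_on_compose[unfolded o_def, of _ _ rGamma]) (auto simp: q_def)
  qed
  also have "q (- of_nat j) = (-1) ^ j * fact j * fact (n - j)"
    using prod_differences_except[OF assms(3), where 'a = complex] by (simp add: q_def)
  then have "H (- of_nat j) = of_real (pochhammer (\<alpha> + real j + 1) n * rGamma (a + real j + 1)) * z ^ j /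
      ((-1) ^ j * fact j * fact (n - j))"
    using assms(2) rGamma_complex_of_real[of "a + real j + 1"] pochhammer_of_real[of "\<alpha> + real j + 1" n, where 'a = complex]
    by (simp add: H_def powr_nat add_ac)
  also have "\<dots> = of_real (cauchy_laguerre_coeff a \<alpha> n j) * z ^ j"
  proof -
    have "\<alpha> + real j + 1 \<notin> \<int>\<^sub>\<le>\<^sub>0"
      using assms(1) by (auto elim!: nonpos_Ints_cases')
    then have "pochhammer (\<alpha> + real j + 1) n = Gamma (\<alpha> + real n + real j + 1) / Gamma (\<alpha> + real j + 1)"
      by (subst pochhammer_Gamma) (simp_all add: add_ac)
    moreover have "inverse ((-1) ^ j :: complex) = (-1) ^ j"
      by (simp flip: power_inverse)
    ultimately show ?thesis
      by (simp add: cauchy_laguerre_coeff_def rGamma_inverse_Gamma divide_inverse)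
  qed
  finally show ?thesis .
qed

lemma mellin_barnes_kernel_holomorphic:
  assumes "z \<noteq> 0"
  shows "mellin_barnes_kernel a \<alpha> n z holomorphic_on - ((\<lambda>k. - of_nat k) ` {..n})"
  unfolding mellin_barnes_kernel_def[abs_def] pochhammer_prod
  using assms
  by (intro holomorphic_intros holomorphic_on_compose[unfolded o_def, of _ _ rGamma])
     (auto simp: add_eq_0_iff2)

text \<open>
  The excluded points are the poles of \<open>\<Gamma>(u)\<close> and \<open>\<Gamma>(\<alpha> + n + 1 - u)\<close>, where these factors are 0 by convention.
  At the poles of the Gamma factors in the denominator division by 0 gives the correct value 0.
\<close>

lemma gamma_quotient_eq_mellin_barnes_kernel:
  assumes "\<And>k. u \<noteq> - of_nat k" "\<And>k. u \<noteq> of_real \<alpha> + of_nat n + 1 + of_nat k"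
  shows "Gamma (of_real \<alpha> + of_nat n - u + 1) * Gamma u /
           (Gamma (of_nat n + 1 + u) * Gamma (of_real \<alpha> + 1 - u) * Gamma (of_real a + 1 - u)) * z powr (- u)
         = mellin_barnes_kernel a \<alpha> n z u"
proof -
  have u: "u \<notin> \<int>\<^sub>\<le>\<^sub>0"
    using assms(1) by (auto elim!: nonpos_Ints_cases')
  have v: "of_real \<alpha> + of_nat n - u + 1 \<notin> \<int>\<^sub>\<le>\<^sub>0"
  proof
    assume "of_real \<alpha> + of_nat n - u + 1 \<in> \<int>\<^sub>\<le>\<^sub>0"
    then obtain k where "of_real \<alpha> + of_nat n - u + 1 = - of_nat k"
      by (auto elim!: nonpos_Ints_cases')
    then have "u = of_real \<alpha> + of_nat n + 1 + of_nat k"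
      by (simp add: algebra_simps)
    with assms(2) show False by blast
  qed
  have "Gamma (of_nat n + 1 + u) = pochhammer u (Suc n) * Gamma u"
    using pochhammer_Gamma[OF u, of "Suc n"] u by (simp add: Gamma_eq_zero_iff add_ac del: pochhammer_Suc)
  moreover have "pochhammer (of_real \<alpha> + 1 - u) n =
      Gamma (of_real \<alpha> + of_nat n - u + 1) / Gamma (of_real \<alpha> + 1 - u)"
  proof -
    have "rGamma (of_real \<alpha> + 1 - u) =
        pochhammer (of_real \<alpha> + 1 - u) n * rGamma (of_real \<alpha> + of_nat n - u + 1)"
      using pochhammer_rGamma[of "of_real \<alpha> + 1 - u" n] by (simp add: algebra_simps)
    with v show ?thesis
      by (simp add: rGamma_inverse_Gamma divide_inverse Gamma_eq_zero_iff)
  qed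
  ultimately show ?thesis
    using u by (simp add: mellin_barnes_kernel_def rGamma_inverse_Gamma divide_inverse Gamma_eq_zero_iff
        del: pochhammer_Suc)
qed

lemma is_pole_Gamma_reflected:
  fixes c :: complex
  shows "is_pole (\<lambda>u. Gamma (c - u)) (c + of_nat k)"
proof -
  have "filterlim (\<lambda>u. c - u) (at (- of_nat k)) (at (c + of_nat k))"
  proof (rule filterlim_atI)
    show "((\<lambda>u. c - u) \<longlongrightarrow> - of_nat k) (at (c + of_nat k))"
      by (auto intro!: tendsto_eq_intros)
    show "\<forall>\<^sub>F u in at (c + of_nat k). c - u \<noteq> - of_nat k"
      by (auto simp: eventually_at_filter algebra_simps)
  qed
  then show ?thesis
    unfolding is_pole_def by (rule filterlim_compose[OF Gamma_poles])
qed

lemma contour_\<gamma>_avoids_poles: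
  assumes "contour_\<gamma> \<alpha> n \<gamma>" "u \<in> range \<gamma>"
  shows "u \<noteq> - of_nat k" "u \<noteq> of_real \<alpha> + of_nat n + 1 + of_nat k"
  using assms is_pole_Gamma[of k] is_pole_Gamma_reflected[of "of_real \<alpha> + of_nat n + 1" k]
  unfolding contour_\<gamma>_def loop_winds_def by (blast, blast)

section \<open>The three expressions\<close>

lemma poly_cauchy_laguerre_p:
  "poly (cauchy_laguerre_p a b n) z = (\<Sum>j\<le>n. of_real (cauchy_laguerre_coeff a (a + b) n j) * z ^ j)"
proof -
  have coeff: "coeff (jacobi01 \<alpha> n) j = Gamma (\<alpha> + real n + real j + 1) /
      (fact j * fact (n - j) * Gamma (\<alpha> + real j + 1)) * (-1) ^ j" if "j \<le> n" for \<alpha> j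
    using that by (simp add: jacobi01_def coeff_sum)
  show ?thesis
    unfolding cauchy_laguerre_p_def poly_sum poly_monom
    by (intro sum.cong refl) (simp add: coeff cauchy_laguerre_coeff_def)
qed

lemma cauchy_laguerre_q_swap: "cauchy_laguerre_q a b n = cauchy_laguerre_p b a n"
  by (simp add: cauchy_laguerre_q_def cauchy_laguerre_p_def add.commute)

text \<open>
  The term of index \<open>j\<close> vanishes for \<open>j > n\<close> because \<open>(- n)\<^sub>j\<close> does; for \<open>j \<le> n\<close> one has
  \<open>(- n)\<^sub>j = (- 1)^j n! / (n - j)!\<close>, and the prefactor cancels the Gamma values at \<open>j = 0\<close> in
  \<open>(x)\<^sub>j = \<Gamma>(x + j) / \<Gamma>(x)\<close>.
\<close>

lemma hypergeometric_2F2_terminating: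
  assumes "a > -1" "\<alpha> > -1"
  shows "of_real (Gamma (\<alpha> + real n + 1) / (fact n * Gamma (\<alpha> + 1) * Gamma (a + 1))) *
      hypergeometric_F [- of_nat n, of_real (\<alpha> + real n + 1)] [of_real (a + 1), of_real (\<alpha> + 1)] z
    = (\<Sum>j\<le>n. of_real (cauchy_laguerre_coeff a \<alpha> n j) * z ^ j)"
proof -
  define F where "F = fps_hypergeo [- of_nat n, of_real (\<alpha> + real n + 1)] [of_real (a + 1), of_real (\<alpha> + 1)] (1::complex)"
  define c where "c = Gamma (\<alpha> + real n + 1) / (fact n * Gamma (\<alpha> + 1) * Gamma (a + 1))"
  have nth: "fps_nth F j = of_real (pochhammer (- real n) j * pochhammer (\<alpha> + real n + 1) j /
      (pochhammer (a + 1) j * pochhammer (\<alpha> + 1) j * fact j))" for j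
    by (simp add: F_def flip: pochhammer_of_real)
  have "fps_nth F j = 0" if "j > n" for j
    using that by (simp add: nth pochhammer_of_nat_eq_0_lemma)
  then have "eval_fps F z = (\<Sum>j\<le>n. fps_nth F j * z ^ j)"
    unfolding eval_fps_def by (intro suminf_finite) auto
  moreover have "of_real c * fps_nth F j = of_real (cauchy_laguerre_coeff a \<alpha> n j)" if "j \<le> n" for j
  proof -
    have notin: "x \<notin> \<int>\<^sub>\<le>\<^sub>0" if "x > 0" for x :: real
      using that by (auto elim!: nonpos_Ints_cases')
    have pos: "Gamma x > 0" if "x > 0" for x :: real
      using that by (rule Gamma_real_pos)
    have rising: "pochhammer x j = Gamma (x + real j) / Gamma x" if "x > 0" for x
      using that by (intro pochhammer_Gamma notin)
    have falling: "pochhammer (- real n) j = (-1) ^ j * fact n / fact (n - j)"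
    proof -
      have "(-1) ^ j * pochhammer (- real n) j / fact j = fact n / (fact j * fact (n - j))"
        using gbinomial_pochhammer[of "real n" j] binomial_fact[OF that, where 'a = real]
        by (simp add: binomial_gbinomial)
      then have "(-1) ^ j * pochhammer (- real n) j = fact n / fact (n - j)"
        by (simp add: divide_simps mult_ac)
      then have "(-1) ^ j * ((-1) ^ j * pochhammer (- real n) j) = (-1) ^ j * (fact n / fact (n - j))"
        by simp
      then show ?thesis by (simp add: mult.assoc[symmetric] flip: power_mult_distrib)
    qed
    have "c * (pochhammer (- real n) j * pochhammer (\<alpha> + real n + 1) j /
        (pochhammer (a + 1) j * pochhammer (\<alpha> + 1) j * fact j)) = cauchy_laguerre_coeff a \<alpha> n j"
    proof -
      have args: "\<alpha> + real n + 1 > 0" "\<alpha> + 1 > 0" "a + 1 > 0"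
        using assms by auto
      show ?thesis
        unfolding c_def cauchy_laguerre_coeff_def falling rising[OF args(1)] rising[OF args(2)] rising[OF args(3)]
        using pos[OF args(1)] pos[OF args(2)] pos[OF args(3)] by (simp add: add_ac)
    qed
    then show ?thesis by (simp only: nth flip: of_real_mult)
  qed
  ultimately have "of_real c * eval_fps F z = (\<Sum>j\<le>n. of_real (cauchy_laguerre_coeff a \<alpha> n j) * z ^ j)"
    by (simp add: sum_distrib_left mult.assoc[symmetric])
  then show ?thesis
    unfolding hypergeometric_F_def F_def c_def .
qed

lemma has_loop_integral_mellin_barnes:
  assumes "a > -1" "\<alpha> > -1" "z \<noteq> 0" and \<gamma>: "contour_\<gamma> \<alpha> n \<gamma>"
  shows "has_loop_integral
      (\<lambda>u. 1 / (2 * of_real pi * \<i>) *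
           (Gamma (of_real \<alpha> + of_nat n - u + 1) * Gamma u /
            (Gamma (of_nat n + 1 + u) * Gamma (of_real \<alpha> + 1 - u) *
             Gamma (of_real a + 1 - u))) * z powr (- u))
      (\<Sum>j\<le>n. of_real (cauchy_laguerre_coeff a \<alpha> n j) * z ^ j) \<gamma>"
proof -
  define S where "S = (\<lambda>k. - of_nat k :: complex) ` {..n}"
  have "has_loop_integral (mellin_barnes_kernel a \<alpha> n z)
      (2 * of_real pi * \<i> * (\<Sum>p\<in>S. residue (mellin_barnes_kernel a \<alpha> n z) p)) \<gamma>"
  proof (rule residue_theorem_loop_from_minus_infinity)
    show "loop_winds \<gamma> p 1" if "p \<in> S" for p
      using that \<gamma> is_pole_Gamma by (auto simp: S_def contour_\<gamma>_def)
  qed (use assms in \<open>auto simp: S_def contour_\<gamma>_def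
         intro: mellin_barnes_kernel_holomorphic mellin_barnes_kernel_decays\<close>)
  also have "(\<Sum>p\<in>S. residue (mellin_barnes_kernel a \<alpha> n z) p) =
      (\<Sum>j\<le>n. of_real (cauchy_laguerre_coeff a \<alpha> n j) * z ^ j)"
    unfolding S_def using assms
    by (subst sum.reindex) (auto simp: inj_on_def residue_mellin_barnes_kernel intro!: sum.cong)
  finally have "has_loop_integral (\<lambda>u. 1 / (2 * of_real pi * \<i>) * mellin_barnes_kernel a \<alpha> n z u)
      (1 / (2 * of_real pi * \<i>) * (2 * of_real pi * \<i> * (\<Sum>j\<le>n. of_real (cauchy_laguerre_coeff a \<alpha> n j) * z ^ j))) \<gamma>"
    by (rule has_loop_integral_lmul)
  then have "has_loop_integral (\<lambda>u. 1 / (2 * of_real pi * \<i>) * mellin_barnes_kernel a \<alpha> n z u)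
      (\<Sum>j\<le>n. of_real (cauchy_laguerre_coeff a \<alpha> n j) * z ^ j) \<gamma>"
    by simp
  then show ?thesis
  proof (rule has_loop_integral_cong[THEN iffD1, rotated])
    fix u assume "u \<in> range \<gamma>"
    then show "1 / (2 * of_real pi * \<i>) * mellin_barnes_kernel a \<alpha> n z u =
        1 / (2 * of_real pi * \<i>) *
           (Gamma (of_real \<alpha> + of_nat n - u + 1) * Gamma u /
            (Gamma (of_nat n + 1 + u) * Gamma (of_real \<alpha> + 1 - u) *
             Gamma (of_real a + 1 - u))) * z powr (- u)"
      by (subst gamma_quotient_eq_mellin_barnes_kernel[of u \<alpha> n a z, symmetric])
         (use contour_\<gamma>_avoids_poles[OF \<gamma>] in \<open>auto simp: mult.assoc\<close>)
  qed
qed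

lemma cauchy_laguerre_p_representations:
  assumes "a > -1" "\<alpha> = a + b" "\<alpha> > -1" "z \<noteq> 0"
  shows
    "poly (cauchy_laguerre_p a b n) z =
        (\<Sum>j\<le>n. of_real (Gamma (\<alpha> + real n + real j + 1)) * (- z) ^ j /
           of_real (fact j * fact (n - j) * Gamma (\<alpha> + real j + 1) * Gamma (a + real j + 1)))
      \<and> poly (cauchy_laguerre_p a b n) z =
        of_real (Gamma (\<alpha> + real n + 1) / (fact n * Gamma (\<alpha> + 1) * Gamma (a + 1))) *
        hypergeometric_F [- of_nat n, of_real (\<alpha> + real n + 1)]
                         [of_real (a + 1), of_real (\<alpha> + 1)] z
      \<and> (\<forall>\<gamma>. contour_\<gamma> \<alpha> n \<gamma> \<longrightarrow>
           has_loop_integral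
             (\<lambda>u. 1 / (2 * of_real pi * \<i>) *
                  (Gamma (of_real \<alpha> + of_nat n - u + 1) * Gamma u /
                   (Gamma (of_nat n + 1 + u) * Gamma (of_real \<alpha> + 1 - u) *
                    Gamma (of_real a + 1 - u))) * z powr (- u))
             (poly (cauchy_laguerre_p a b n) z) \<gamma>)"
proof (intro conjI allI impI)
  show "poly (cauchy_laguerre_p a b n) z =
        (\<Sum>j\<le>n. of_real (Gamma (\<alpha> + real n + real j + 1)) * (- z) ^ j /
           of_real (fact j * fact (n - j) * Gamma (\<alpha> + real j + 1) * Gamma (a + real j + 1)))"
    unfolding poly_cauchy_laguerre_p assms(2)[symmetric]
    by (intro sum.cong refl) (simp add: cauchy_laguerre_coeff_def power_minus[of z])
  show "poly (cauchy_laguerre_p a b n) z =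
        of_real (Gamma (\<alpha> + real n + 1) / (fact n * Gamma (\<alpha> + 1) * Gamma (a + 1))) *
        hypergeometric_F [- of_nat n, of_real (\<alpha> + real n + 1)]
                         [of_real (a + 1), of_real (\<alpha> + 1)] z"
    unfolding poly_cauchy_laguerre_p assms(2)[symmetric]
    by (rule hypergeometric_2F2_terminating[symmetric]) (use assms in auto)
next
  fix \<gamma> assume "contour_\<gamma> \<alpha> n \<gamma>"
  then show "has_loop_integral
             (\<lambda>u. 1 / (2 * of_real pi * \<i>) *
                  (Gamma (of_real \<alpha> + of_nat n - u + 1) * Gamma u /
                   (Gamma (of_nat n + 1 + u) * Gamma (of_real \<alpha> + 1 - u) *
                    Gamma (of_real a + 1 - u))) * z powr (- u))
             (poly (cauchy_laguerre_p a b n) z) \<gamma>"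
    unfolding poly_cauchy_laguerre_p assms(2)[symmetric]
    by (intro has_loop_integral_mellin_barnes) (use assms in auto)
qed

theorem theorem5p1:
  fixes a b \<alpha> :: real and n :: nat and z :: complex
  assumes "a > -1" and "b > -1" and "\<alpha> = a + b" and "\<alpha> > -1" and "z \<noteq> 0"
  shows
    "(poly (cauchy_laguerre_p a b n) z =
        (\<Sum>j\<le>n. of_real (Gamma (\<alpha> + real n + real j + 1)) * (- z) ^ j /
           of_real (fact j * fact (n - j) * Gamma (\<alpha> + real j + 1) * Gamma (a + real j + 1)))
      \<and> poly (cauchy_laguerre_p a b n) z =
        of_real (Gamma (\<alpha> + real n + 1) / (fact n * Gamma (\<alpha> + 1) * Gamma (a + 1))) *
        hypergeometric_F [- of_nat n, of_real (\<alpha> + real n + 1)]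
                         [of_real (a + 1), of_real (\<alpha> + 1)] z
      \<and> (\<forall>\<gamma>. contour_\<gamma> \<alpha> n \<gamma> \<longrightarrow>
           has_loop_integral
             (\<lambda>u. 1 / (2 * of_real pi * \<i>) *
                  (Gamma (of_real \<alpha> + of_nat n - u + 1) * Gamma u /
                   (Gamma (of_nat n + 1 + u) * Gamma (of_real \<alpha> + 1 - u) *
                    Gamma (of_real a + 1 - u))) * z powr (- u))
             (poly (cauchy_laguerre_p a b n) z) \<gamma>))
   \<and> (poly (cauchy_laguerre_q a b n) z =
        (\<Sum>j\<le>n. of_real (Gamma (\<alpha> + real n + real j + 1)) * (- z) ^ j /
           of_real (fact j * fact (n - j) * Gamma (\<alpha> + real j + 1) * Gamma (b + real j + 1)))
      \<and> poly (cauchy_laguerre_q a b n) z =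
        of_real (Gamma (\<alpha> + real n + 1) / (fact n * Gamma (\<alpha> + 1) * Gamma (b + 1))) *
        hypergeometric_F [- of_nat n, of_real (\<alpha> + real n + 1)]
                         [of_real (b + 1), of_real (\<alpha> + 1)] z
      \<and> (\<forall>\<gamma>. contour_\<gamma> \<alpha> n \<gamma> \<longrightarrow>
           has_loop_integral
             (\<lambda>u. 1 / (2 * of_real pi * \<i>) *
                  (Gamma (of_real \<alpha> + of_nat n - u + 1) * Gamma u /
                   (Gamma (of_nat n + 1 + u) * Gamma (of_real \<alpha> + 1 - u) *
                    Gamma (of_real b + 1 - u))) * z powr (- u))
             (poly (cauchy_laguerre_q a b n) z) \<gamma>))"
  unfolding cauchy_laguerre_q_swap
  by (rule conjI; rule cauchy_laguerre_p_representations) (use assms in auto)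

end
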